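(* Let $\Omega\subset\mathbb{C}$ be a bounded domain and let $X\subset\mathcal{H}(\Omega)$ be a Banach space of analytic functions on $\Omega$ satisfying the axioms: (A1) all point evaluation functionals $\Lambda_z$, $z\in\Omega$, are bounded on $X$; (A2) $f_0\in X$, where $f_0(z)\equiv1$; (A3) the shift operator $f(z)\mapsto zf(z)$ is bounded on $X$; (A4) for every function $f\in X$, $\dfrac{|f(z)|}{\|\Lambda_z\|}\to0$ as $\mathrm{dist}(z,\partial\Omega)\to0$. Suppose that the weighted composition operator $T_{F,\varphi}$ is bounded on $X$. (a) If $T_{F,\varphi}$ is invertible on $X$, then its composition symbol $\varphi$ is an automorphism of $\Omega$ and the multiplication symbol $F$ does not vanish in $\Omega$. (b) Assume in addition: (A5) each automorphism of $\Omega$ induces a bounded composition operator on $X$. Then $T_{F,\varphi}$ is invertible on $X$ if and only if its composition symbol $\varphi$ is an automorphism of $\Omega$, the multiplication symbol $F$ does not vanish in $\Omega$, and $1/F\in\mathcal{M}(X)$. If this is the case, then $F$ is also a self-multiplier of $X$ (that is, $F\in\mathcal{M}(X)$) and the inverse operator is $T_{G,\psi}$ with $$G=\frac{1}{F\circ\varphi^{-1}},\qquad\psi=\varphi^{-1}.$$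
   Context: A domain is an open connected subset of $\mathbb{C}$ (no further connectivity assumption is made), and $\mathcal{H}(\Omega)$ is the algebra of analytic functions on $\Omega$. $\Lambda_z(f)=f(z)$ for $f\in X$, and $\|\Lambda_z\|$ is its norm as a functional on $X$ (positive by (A2)). For $F\in\mathcal{H}(\Omega)$ and an analytic map $\varphi\colon\Omega\to\Omega$, the weighted composition operator with multiplication symbol $F$ and composition symbol $\varphi$ is $T_{F,\varphi}f=F\cdot(f\circ\varphi)$. The composition operator with symbol $\varphi$ is $C_\varphi f=f\circ\varphi$. An automorphism of $\Omega$ is a bijective analytic map of $\Omega$ onto itself. $\mathcal{M}(X)$ is the set of pointwise multipliers (self-multipliers) of $X$: functions $F\in\mathcal{H}(\Omega)$ such that $Ff\in X$ for all $f\in X$ (the operator $M_Ff=Ff$ is then automatically bounded on $X$). *)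

theory Defs
  imports "HOL-Complex_Analysis.Complex_Analysis"
begin

text \<open>
  An element of \<open>X\<close> is represented by the function on the whole plane that extends it by zero
  outside \<open>\<Omega>\<close>, so that equality in \<open>X\<close> is equality of functions on \<open>\<Omega>\<close>. HOL-Analysis has no class
  of complex normed spaces, hence the norm is an explicit parameter, constrained only on \<open>X\<close>.
\<close>

locale banach_space_of_analytic_functions =
  fixes \<Omega> :: "complex set" and X :: "(complex \<Rightarrow> complex) set"
    and nrm :: "(complex \<Rightarrow> complex) \<Rightarrow> real"
  assumes holomorphic: "f \<in> X \<Longrightarrow> f holomorphic_on \<Omega>"
    and zero_outside: "f \<in> X \<Longrightarrow> z \<notin> \<Omega> \<Longrightarrow> f z = 0"
    and zero_mem: "(\<lambda>z. 0) \<in> X"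
    and add_mem: "f \<in> X \<Longrightarrow> g \<in> X \<Longrightarrow> (\<lambda>z. f z + g z) \<in> X"
    and scale_mem: "f \<in> X \<Longrightarrow> (\<lambda>z. c * f z) \<in> X"
    and nrm_nonneg: "f \<in> X \<Longrightarrow> 0 \<le> nrm f"
    and nrm_eq_0: "f \<in> X \<Longrightarrow> nrm f = 0 \<longleftrightarrow> f = (\<lambda>z. 0)"
    and nrm_triangle: "f \<in> X \<Longrightarrow> g \<in> X \<Longrightarrow> nrm (\<lambda>z. f z + g z) \<le> nrm f + nrm g"
    and nrm_scale: "f \<in> X \<Longrightarrow> nrm (\<lambda>z. c * f z) = cmod c * nrm f"
    and complete:
      "(\<And>n. s n \<in> X) \<Longrightarrow>
       (\<And>e. e > 0 \<Longrightarrow> \<exists>M. \<forall>m\<ge>M. \<forall>n\<ge>M. nrm (\<lambda>z. s m z - s n z) < e) \<Longrightarrow>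
       \<exists>f\<in>X. (\<lambda>n::nat. nrm (\<lambda>z. s n z - f z)) \<longlonglongrightarrow> 0"

definition restrict0 :: "complex set \<Rightarrow> (complex \<Rightarrow> complex) \<Rightarrow> complex \<Rightarrow> complex" where
  "restrict0 \<Omega> f = (\<lambda>z. if z \<in> \<Omega> then f z else 0)"

definition bounded_functional ::
  "(complex \<Rightarrow> complex) set \<Rightarrow> ((complex \<Rightarrow> complex) \<Rightarrow> real) \<Rightarrow>
   ((complex \<Rightarrow> complex) \<Rightarrow> complex) \<Rightarrow> bool" where
  "bounded_functional X nrm L \<longleftrightarrow>
     (\<forall>f\<in>X. \<forall>g\<in>X. L (\<lambda>z. f z + g z) = L f + L g) \<and>
     (\<forall>f\<in>X. \<forall>c. L (\<lambda>z. c * f z) = c * L f) \<and>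
     (\<exists>K. \<forall>f\<in>X. cmod (L f) \<le> K * nrm f)"

definition functional_norm ::
  "(complex \<Rightarrow> complex) set \<Rightarrow> ((complex \<Rightarrow> complex) \<Rightarrow> real) \<Rightarrow>
   ((complex \<Rightarrow> complex) \<Rightarrow> complex) \<Rightarrow> real" where
  "functional_norm X nrm L = Sup {cmod (L f) |f. f \<in> X \<and> nrm f \<le> 1}"

definition point_eval :: "complex \<Rightarrow> (complex \<Rightarrow> complex) \<Rightarrow> complex" where
  "point_eval z f = f z"

definition bounded_operator ::
  "(complex \<Rightarrow> complex) set \<Rightarrow> ((complex \<Rightarrow> complex) \<Rightarrow> real) \<Rightarrow>
   ((complex \<Rightarrow> complex) \<Rightarrow> (complex \<Rightarrow> complex)) \<Rightarrow> bool" where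
  "bounded_operator X nrm T \<longleftrightarrow>
     (\<forall>f\<in>X. T f \<in> X) \<and>
     (\<forall>f\<in>X. \<forall>g\<in>X. T (\<lambda>z. f z + g z) = (\<lambda>z. T f z + T g z)) \<and>
     (\<forall>f\<in>X. \<forall>c. T (\<lambda>z. c * f z) = (\<lambda>z. c * T f z)) \<and>
     (\<exists>K. \<forall>f\<in>X. nrm (T f) \<le> K * nrm f)"

definition inverse_operator ::
  "(complex \<Rightarrow> complex) set \<Rightarrow> ((complex \<Rightarrow> complex) \<Rightarrow> real) \<Rightarrow>
   ((complex \<Rightarrow> complex) \<Rightarrow> (complex \<Rightarrow> complex)) \<Rightarrow>
   ((complex \<Rightarrow> complex) \<Rightarrow> (complex \<Rightarrow> complex)) \<Rightarrow> bool" where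
  "inverse_operator X nrm T S \<longleftrightarrow>
     bounded_operator X nrm S \<and> (\<forall>f\<in>X. S (T f) = f \<and> T (S f) = f)"

definition invertible_operator ::
  "(complex \<Rightarrow> complex) set \<Rightarrow> ((complex \<Rightarrow> complex) \<Rightarrow> real) \<Rightarrow>
   ((complex \<Rightarrow> complex) \<Rightarrow> (complex \<Rightarrow> complex)) \<Rightarrow> bool" where
  "invertible_operator X nrm T \<longleftrightarrow>
     bounded_operator X nrm T \<and> (\<exists>S. inverse_operator X nrm T S)"

text \<open>
  Symbols and multipliers matter only through their values on \<open>\<Omega>\<close>; their values elsewhere are
  unconstrained.
\<close>

definition wco_symbols ::
  "complex set \<Rightarrow> (complex \<Rightarrow> complex) \<Rightarrow> (complex \<Rightarrow> complex) \<Rightarrow> bool" where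
  "wco_symbols \<Omega> F \<phi> \<longleftrightarrow>
     F holomorphic_on \<Omega> \<and> \<phi> holomorphic_on \<Omega> \<and> \<phi> ` \<Omega> \<subseteq> \<Omega>"

definition weighted_comp_op ::
  "complex set \<Rightarrow> (complex \<Rightarrow> complex) \<Rightarrow> (complex \<Rightarrow> complex) \<Rightarrow>
   (complex \<Rightarrow> complex) \<Rightarrow> (complex \<Rightarrow> complex)" where
  "weighted_comp_op \<Omega> F \<phi> f = restrict0 \<Omega> (\<lambda>z. F z * f (\<phi> z))"

definition comp_op ::
  "complex set \<Rightarrow> (complex \<Rightarrow> complex) \<Rightarrow> (complex \<Rightarrow> complex) \<Rightarrow> (complex \<Rightarrow> complex)" where
  "comp_op \<Omega> \<phi> f = restrict0 \<Omega> (f \<circ> \<phi>)"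

definition automorphism :: "complex set \<Rightarrow> (complex \<Rightarrow> complex) \<Rightarrow> bool" where
  "automorphism \<Omega> \<phi> \<longleftrightarrow> \<phi> holomorphic_on \<Omega> \<and> bij_betw \<phi> \<Omega> \<Omega>"

definition multipliers ::
  "complex set \<Rightarrow> (complex \<Rightarrow> complex) set \<Rightarrow> (complex \<Rightarrow> complex) set" where
  "multipliers \<Omega> X = {F. F holomorphic_on \<Omega> \<and> (\<forall>f\<in>X. (\<lambda>z. F z * f z) \<in> X)}"

end

theory Submission
  imports Defs
begin

text \<open>
  Write \<open>T\<close> for the operator \<open>T_{F,\<phi>}\<close>. If \<open>T\<close> is onto, the constant \<open>1\<close> and the coordinate
  function \<open>z\<close> belong to its range, which makes \<open>F\<close> zero-free and \<open>\<phi>\<close> injective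
  (\<open>surj_weighted_comp_op_imp_nonzero_inj\<close>). Surjectivity of \<open>\<phi>\<close> is the heart of the matter. If it
  failed, there would be points \<open>z\<close> approaching the frontier of \<open>\<Omega>\<close> whose images stay near one point
  of \<open>\<Omega>\<close> (\<open>non_surjective_self_map_near_frontier\<close>). Evaluations at those images are uniformly
  bounded, and with a bounded inverse of \<open>T\<close> this bounds the norm of the evaluation at \<open>z\<close> by a
  constant times \<open>cmod (F z)\<close>. But \<open>F = T 1\<close> is an element of \<open>X\<close>, and by axiom A4 it is of
  smaller order than these norms near the frontier.

  Once \<open>\<phi>\<close> is an automorphism and \<open>F\<close> is zero-free, \<open>T\<close> has an inverse on functions, namely
  \<open>T_{G,\<psi>}\<close> with \<open>\<psi> = \<phi>\<^sup>-\<^sup>1\<close> and \<open>G = 1 / (F \<circ> \<psi>)\<close>, and the question is only whether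
  \<open>T_{G,\<psi>}\<close> maps \<open>X\<close> into itself. It is division by \<open>F\<close> followed by composition with \<open>\<psi>\<close>, and A5
  lets compositions with automorphisms be inserted and removed freely, so this happens exactly when
  \<open>1 / F\<close> is a multiplier.

  Two facts of functional analysis are used: evaluations at the points of a compact set are
  uniformly bounded (\<open>point_evals_bounded_on_compact\<close>), and a weighted composition operator mapping
  \<open>X\<close> into itself is bounded (\<open>weighted_comp_op_automatically_bounded\<close>). Both follow from
  completeness through Zabreiko's lemma on countably subadditive seminorms
  (\<open>countably_subadditive_seminorm_bounded\<close>).
\<close>

section \<open>Automatic boundedness on a Banach space of analytic functions\<close>

context banach_space_of_analytic_functions
begin

lemma diff_mem:
  assumes "f \<in> X" "g \<in> X"
  shows "(\<lambda>z. f z - g z) \<in> X"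
  using add_mem[OF assms(1) scale_mem[OF assms(2), of "- 1"]] by simp

lemma sum_mem:
  assumes "\<And>j. j \<in> J \<Longrightarrow> u j \<in> X"
  shows "(\<lambda>z. \<Sum>j\<in>J. u j z) \<in> X"
  using assms by (induction J rule: infinite_finite_induct) (auto intro: zero_mem add_mem)

lemma nrm_zero: "nrm (\<lambda>z. 0) = 0"
  using nrm_eq_0[OF zero_mem] by simp

lemma nrm_diff_commute:
  assumes "f \<in> X" "g \<in> X"
  shows "nrm (\<lambda>z. f z - g z) = nrm (\<lambda>z. g z - f z)"
  using nrm_scale[OF diff_mem[OF assms], of "- 1"] by simp

lemma nrm_diff_triangle:
  assumes "f \<in> X" "g \<in> X" "h \<in> X"
  shows "nrm (\<lambda>z. f z - h z) \<le> nrm (\<lambda>z. f z - g z) + nrm (\<lambda>z. g z - h z)"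
  using nrm_triangle[OF diff_mem[OF assms(1,2)] diff_mem[OF assms(2,3)]] by simp

lemma nrm_sum_le:
  assumes "\<And>j. j \<in> J \<Longrightarrow> u j \<in> X"
  shows "nrm (\<lambda>z. \<Sum>j\<in>J. u j z) \<le> (\<Sum>j\<in>J. nrm (u j))"
  using assms
proof (induction J rule: infinite_finite_induct)
  case (insert j J)
  have "nrm (\<lambda>z. u j z + (\<Sum>i\<in>J. u i z)) \<le> nrm (u j) + nrm (\<lambda>z. \<Sum>i\<in>J. u i z)"
    using insert.prems by (intro nrm_triangle sum_mem) auto
  then show ?case
    using insert by fastforce
qed (simp_all add: nrm_zero)

lemma absolutely_convergent_series:
  assumes u: "\<And>n. u n \<in> X" and summable: "summable (\<lambda>n. nrm (u n))"
  obtains g where "g \<in> X" "(\<lambda>n. nrm (\<lambda>z. g z - (\<Sum>j<n. u j z))) \<longlonglongrightarrow> 0"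
    "nrm g \<le> (\<Sum>n. nrm (u n))"
proof -
  define s where "s n = (\<lambda>z. \<Sum>j<n. u j z)" for n :: nat
  have s: "s n \<in> X" for n
    unfolding s_def using u by (intro sum_mem)
  have s_diff: "nrm (\<lambda>z. s m z - s n z) \<le> (\<Sum>j\<in>{n..<m}. nrm (u j))" if "n \<le> m" for m n
  proof -
    have "s m z - s n z = (\<Sum>j\<in>{n..<m}. u j z)" for z
      using sum_diff_nat_ivl[of 0 n m "\<lambda>j. u j z"] that
      by (simp add: s_def atLeast0LessThan)
    then show ?thesis
      using nrm_sum_le[of "{n..<m}" u] u by simp
  qed
  have cauchy: "\<exists>M. \<forall>m\<ge>M. \<forall>n\<ge>M. nrm (\<lambda>z. s m z - s n z) < e" if "e > 0" for e
  proof -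
    obtain M where M: "\<And>m n. m \<ge> M \<Longrightarrow> norm (\<Sum>j\<in>{m..<n}. nrm (u j)) < e"
      using summable \<open>e > 0\<close> unfolding summable_Cauchy by blast
    have "nrm (\<lambda>z. s m z - s n z) < e" if "m \<ge> M" "n \<ge> M" for m n
    proof (cases "n \<le> m")
      case True
      then show ?thesis
        using s_diff[OF True] M[OF \<open>n \<ge> M\<close>, of m] by simp
    next
      case False
      then show ?thesis
        using s_diff[of m n] M[OF \<open>m \<ge> M\<close>, of n] nrm_diff_commute[OF s s, of m n] by simp
    qed
    then show ?thesis by blast
  qed
  obtain g where g: "g \<in> X" and lim: "(\<lambda>n. nrm (\<lambda>z. s n z - g z)) \<longlonglongrightarrow> 0"
    using complete[of s] s cauchy by blast
  have lim': "(\<lambda>n. nrm (\<lambda>z. g z - s n z)) \<longlonglongrightarrow> 0"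
    using lim nrm_diff_commute[OF g s] by simp
  have "nrm g \<le> nrm (\<lambda>z. g z - s n z) + (\<Sum>j<n. nrm (u j))" for n
    using nrm_triangle[OF diff_mem[OF g s] s, of n n] nrm_sum_le[of "{..<n}" u] u
    by (simp add: s_def)
  moreover have "(\<lambda>n. nrm (\<lambda>z. g z - s n z) + (\<Sum>j<n. nrm (u j))) \<longlonglongrightarrow> 0 + (\<Sum>n. nrm (u n))"
    by (intro tendsto_add lim' summable_LIMSEQ summable)
  ultimately have "nrm g \<le> 0 + (\<Sum>n. nrm (u n))"
    by (intro LIMSEQ_le_const) auto
  with that g lim' show ?thesis
    by (simp add: s_def)
qed

text \<open>
  Completeness enters everything below through Baire's theorem in this form. The metric has the
  default value \<open>0\<close> off \<open>X\<close>, because there \<open>nrm\<close> may even be negative.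
\<close>

lemma some_closure_contains_ball:
  assumes cover: "\<And>f. f \<in> X \<Longrightarrow> \<exists>k::nat. f \<in> A k" and sub: "\<And>k. A k \<subseteq> X"
  obtains k f r where "f \<in> X" "r > 0"
    "\<And>g e. g \<in> X \<Longrightarrow> nrm (\<lambda>z. f z - g z) < r \<Longrightarrow> e > 0 \<Longrightarrow> \<exists>h\<in>A k. nrm (\<lambda>z. g z - h z) < e"
proof -
  define d where "d f g = (if f \<in> X \<and> g \<in> X then nrm (\<lambda>z. f z - g z) else 0)" for f g
  interpret M: Metric_space X d
  proof
    show "d f g = d g f" for f g
      using nrm_diff_commute[of f g] by (auto simp: d_def)
    show "d f g = 0 \<longleftrightarrow> f = g" if "f \<in> X" "g \<in> X" for f g
      using that nrm_eq_0[OF diff_mem[OF that]] by (simp add: d_def fun_eq_iff)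
  qed (simp_all add: d_def nrm_nonneg diff_mem nrm_diff_triangle)
  have "M.mcomplete"
    unfolding M.mcomplete_def
  proof (intro allI impI)
    fix s assume "M.MCauchy s"
    then have s: "\<And>n. s n \<in> X"
      and cauchy: "\<And>e. e > 0 \<Longrightarrow> \<exists>N. \<forall>m\<ge>N. \<forall>n\<ge>N. d (s m) (s n) < e"
      unfolding M.MCauchy_def by auto
    obtain f where f: "f \<in> X" "(\<lambda>n. nrm (\<lambda>z. s n z - f z)) \<longlonglongrightarrow> 0"
      using complete[of s] s cauchy by (auto simp: d_def)
    then have "(\<lambda>n. d (s n) f) \<longlonglongrightarrow> 0"
      using s by (simp add: d_def)
    then have "limitin M.mtopology s f sequentially"
      using s f(1) by (simp add: M.limitin_metric_dist_null)
    then show "\<exists>f. limitin M.mtopology s f sequentially" by blast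
  qed
  have "\<Union> (range (\<lambda>k. M.mtopology closure_of A k)) = X"
  proof
    show "\<Union> (range (\<lambda>k. M.mtopology closure_of A k)) \<subseteq> X"
      using closure_of_subset_topspace[of M.mtopology] by auto
    show "X \<subseteq> \<Union> (range (\<lambda>k. M.mtopology closure_of A k))"
    proof
      fix f assume "f \<in> X"
      then obtain k where "f \<in> A k"
        using cover[of f] by auto
      moreover have "A k \<subseteq> M.mtopology closure_of A k"
        using sub[of k] by (intro closure_of_subset) simp
      ultimately show "f \<in> \<Union> (range (\<lambda>k. M.mtopology closure_of A k))"
        by (intro UN_I[of k]) auto
    qed
  qed
  moreover have "M.mtopology interior_of X \<noteq> {}"
    using zero_mem interior_of_topspace[of M.mtopology] by auto
  ultimately obtain k where "M.mtopology interior_of (M.mtopology closure_of A k) \<noteq> {}"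
    using M.metric_Baire_category_alt[OF \<open>M.mcomplete\<close>, of "range (\<lambda>k. M.mtopology closure_of A k)"]
    by force
  then obtain f r where f: "f \<in> X" "r > 0" "M.mball f r \<subseteq> M.mtopology closure_of A k"
    by (auto simp: M.metric_interior_of)
  show ?thesis
  proof (rule that[OF f(1,2)])
    fix g and e :: real
    assume g: "g \<in> X" "nrm (\<lambda>z. f z - g z) < r" and "e > 0"
    then have "g \<in> M.mtopology closure_of A k"
      using f by (auto simp: d_def)
    with \<open>e > 0\<close> obtain h where "h \<in> A k" "h \<in> M.mball g e"
      by (auto simp: M.metric_closure_of)
    then show "\<exists>h\<in>A k. nrm (\<lambda>z. g z - h z) < e"
      by (auto simp: d_def)
  qed
qed

text \<open>
  Zabreiko's lemma: a countably subadditive seminorm is bounded. By Baire some level set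
  \<open>{h. p h \<le> k}\<close> is dense in a ball, and being convex and symmetric it is dense in a ball around
  \<open>0\<close>. Each element \<open>f\<close> of that ball is therefore the sum of a series whose \<open>n\<close>-th term \<open>u n\<close>
  satisfies \<open>p (u n) \<le> k / 2 ^ n\<close>, which gives \<open>p f \<le> 2 k\<close>. Both the uniform boundedness principle
  and the closed graph argument below are choices of \<open>p\<close>.
\<close>

lemma countably_subadditive_seminorm_bounded:
  assumes nonneg: "\<And>f. f \<in> X \<Longrightarrow> 0 \<le> p f"
    and scale: "\<And>f c. f \<in> X \<Longrightarrow> p (\<lambda>z. c * f z) = cmod c * p f"
    and triangle: "\<And>f g. f \<in> X \<Longrightarrow> g \<in> X \<Longrightarrow> p (\<lambda>z. f z + g z) \<le> p f + p g"
    and subadditive: "\<And>f u. f \<in> X \<Longrightarrow> (\<And>n::nat. u n \<in> X) \<Longrightarrow>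
      (\<lambda>n. nrm (\<lambda>z. f z - (\<Sum>j<n. u j z))) \<longlonglongrightarrow> 0 \<Longrightarrow> summable (\<lambda>n. p (u n)) \<Longrightarrow>
      p f \<le> (\<Sum>n. p (u n))"
  obtains C :: real where "C > 0" "\<And>f. f \<in> X \<Longrightarrow> p f \<le> C * nrm f"
proof -
  define A where "A k = {f \<in> X. p f \<le> real k}" for k
  have "\<exists>k. f \<in> A k" if "f \<in> X" for f
    using that real_arch_simple[of "p f"] by (auto simp: A_def)
  then obtain k f0 r where f0: "f0 \<in> X" "r > 0"
    and dense: "\<And>g e. g \<in> X \<Longrightarrow> nrm (\<lambda>z. f0 z - g z) < r \<Longrightarrow> e > 0 \<Longrightarrow>
      \<exists>h\<in>A k. nrm (\<lambda>z. g z - h z) < e"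
  proof (rule some_closure_contains_ball[of A])
    show "A k \<subseteq> X" for k
      by (auto simp: A_def)
  qed blast+
  define K where "K = real k"
  have "K \<ge> 0" by (simp add: K_def)
  \<comment> \<open>Averaging an approximation of \<open>f0 + g\<close> with the negative of one of \<open>f0 - g\<close> moves the centre
    of the ball to \<open>0\<close>.\<close>
  have dense0: "\<exists>h\<in>X. p h \<le> K \<and> nrm (\<lambda>z. g z - h z) < e"
    if g: "g \<in> X" "nrm g < r" and "e > 0" for g e
  proof -
    have "nrm (\<lambda>z. f0 z - (f0 z + g z)) < r"
      using g nrm_scale[OF g(1), of "-1"] by simp
    then obtain h1 where h1: "h1 \<in> A k" "nrm (\<lambda>z. (f0 z + g z) - h1 z) < e"
      using dense[OF add_mem[OF f0(1) g(1)] _ \<open>e > 0\<close>] by blast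
    have "nrm (\<lambda>z. f0 z - (f0 z - g z)) < r"
      using g by simp
    then obtain h2 where h2: "h2 \<in> A k" "nrm (\<lambda>z. (f0 z - g z) - h2 z) < e"
      using dense[OF diff_mem[OF f0(1) g(1)] _ \<open>e > 0\<close>] by blast
    have X: "h1 \<in> X" "h2 \<in> X" and p: "p h1 \<le> K" "p h2 \<le> K"
      using h1 h2 by (auto simp: A_def K_def)
    define h where "h = (\<lambda>z. (1/2) * (h1 z + (-1) * h2 z))"
    have sum: "(\<lambda>z. h1 z + (-1) * h2 z) \<in> X"
      by (rule add_mem[OF X(1) scale_mem[OF X(2)]])
    have "h \<in> X"
      unfolding h_def by (rule scale_mem[OF sum])
    have "p (\<lambda>z. h1 z + (-1) * h2 z) \<le> p h1 + p h2"
      using triangle[OF X(1) scale_mem[OF X(2)], of "-1"] scale[OF X(2), of "-1"] by simp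
    then have "p h \<le> K"
      using scale[OF sum, of "1/2"] p by (simp add: h_def)
    define d1 where "d1 = (\<lambda>z. (f0 z + g z) - h1 z)"
    define d2 where "d2 = (\<lambda>z. (f0 z - g z) - h2 z)"
    have d: "d1 \<in> X" "d2 \<in> X"
      unfolding d1_def d2_def using f0 g X by (auto intro: diff_mem add_mem)
    have "nrm (\<lambda>z. d1 z + (-1) * d2 z) \<le> nrm d1 + nrm d2"
      using nrm_triangle[OF d(1) scale_mem[OF d(2)], of "-1"] nrm_scale[OF d(2), of "-1"] by simp
    also have "\<dots> < 2 * e"
      using h1(2) h2(2) by (simp add: d1_def d2_def)
    finally have lt: "nrm (\<lambda>z. d1 z + (-1) * d2 z) < 2 * e" .
    have "(\<lambda>z. d1 z + (-1) * d2 z) \<in> X"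
      by (rule add_mem[OF d(1) scale_mem[OF d(2)]])
    from nrm_scale[OF this, of "1/2"] lt
    have "nrm (\<lambda>z. (1/2) * (d1 z + (-1) * d2 z)) < e"
      by simp
    also have "(\<lambda>z. (1/2) * (d1 z + (-1) * d2 z)) = (\<lambda>z. g z - h z)"
      by (auto simp: d1_def d2_def h_def field_simps)
    finally show ?thesis
      using \<open>h \<in> X\<close> \<open>p h \<le> K\<close> by blast
  qed
  have approx: "\<exists>h\<in>X. p h \<le> K * t \<and> nrm (\<lambda>z. g z - h z) < e"
    if g: "g \<in> X" "nrm g < r * t" and "t > 0" "e > 0" for g t e
  proof -
    define g' where "g' = (\<lambda>z. of_real (1/t) * g z)"
    have "g' \<in> X"
      unfolding g'_def by (rule scale_mem[OF g(1)])
    moreover have "nrm g' < r"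
      using nrm_scale[OF g(1), of "of_real (1/t)"] g(2) \<open>t > 0\<close>
        pos_divide_less_eq[OF \<open>t > 0\<close>, of "nrm g" r]
      by (simp add: g'_def norm_divide)
    ultimately obtain h' where h': "h' \<in> X" "p h' \<le> K" "nrm (\<lambda>z. g' z - h' z) < e / t"
      using dense0[of g' "e / t"] \<open>t > 0\<close> \<open>e > 0\<close> by auto
    define h where "h = (\<lambda>z. of_real t * h' z)"
    have "h \<in> X"
      unfolding h_def by (rule scale_mem[OF h'(1)])
    moreover have "p h \<le> K * t"
      using scale[OF h'(1), of "of_real t"] h'(2) \<open>t > 0\<close> by (simp add: h_def mult.commute)
    moreover have "(\<lambda>z. of_real t * (g' z - h' z)) = (\<lambda>z. g z - h z)"
      using \<open>t > 0\<close> by (auto simp: h_def g'_def field_simps)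
    then have "nrm (\<lambda>z. g z - h z) < e"
      using nrm_scale[OF diff_mem[OF \<open>g' \<in> X\<close> h'(1)], of "of_real t"] h'(3) \<open>t > 0\<close>
      by (simp add: field_simps)
    ultimately show ?thesis by blast
  qed
  have ball: "p f \<le> 2 * K" if f: "f \<in> X" "nrm f < r" for f
  proof -
    define good where
      "good n g h \<longleftrightarrow> h \<in> X \<and> p h \<le> K * (1/2) ^ n \<and> nrm (\<lambda>z. g z - h z) < r * (1/2) ^ Suc n"
      for n g h
    define H where "H n g = (SOME h. good n g h)" for n g
    have "good n g (H n g)" if "g \<in> X" "nrm g < r * (1/2) ^ n" for g n
    proof -
      have "\<exists>h. good n g h"
        using approx[of g "(1/2) ^ n" "r * (1/2) ^ Suc n"] that f0(2) by (auto simp: good_def)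
      then show ?thesis
        unfolding H_def by (rule someI_ex)
    qed
    then have H: "H n g \<in> X" "p (H n g) \<le> K * (1/2) ^ n"
      "nrm (\<lambda>z. g z - H n g z) < r * (1/2) ^ Suc n"
      if "g \<in> X" "nrm g < r * (1/2) ^ n" for g n
      using that unfolding good_def by blast+
    define R where "R = rec_nat f (\<lambda>n g z. g z - H n g z)"
    have R0: "R 0 = f" and RSuc: "R (Suc n) = (\<lambda>z. R n z - H n (R n) z)" for n
      by (simp_all add: R_def)
    have R: "R n \<in> X \<and> nrm (R n) < r * (1/2) ^ n" for n
    proof (induction n)
      case (Suc n)
      then show ?case
        unfolding RSuc using H(1,3)[of "R n" n] diff_mem[of "R n" "H n (R n)"] by simp
    qed (use f R0 in simp)
    define u where "u n = H n (R n)" for n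
    have u: "u n \<in> X" "p (u n) \<le> K * (1/2) ^ n" for n
      using H[of "R n" n] R[of n] by (auto simp: u_def)
    have sum_u: "(\<lambda>z. f z - (\<Sum>j<n. u j z)) = R n" for n
      by (induction n) (auto simp: R0 RSuc u_def fun_eq_iff)
    have geometric: "summable (\<lambda>n. K * (1/2) ^ n)" "(\<Sum>n. K * (1/2) ^ n) = 2 * K"
      using suminf_mult[of "\<lambda>n. (1/2::real) ^ n" K] summable_geometric[of "1/2::real"]
        suminf_geometric[of "1/2::real"] by (auto intro: summable_mult)
    have summable: "summable (\<lambda>n. p (u n))"
      by (rule summable_comparison_test'[OF geometric(1), of 0]) (use u nonneg in auto)
    have "(\<lambda>n. nrm (R n)) \<longlonglongrightarrow> 0"
    proof (rule tendsto_sandwich[of "\<lambda>_. 0"])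
      show "(\<lambda>n. r * (1/2) ^ n) \<longlonglongrightarrow> 0"
        by (intro tendsto_mult_right_zero LIMSEQ_power_zero) simp
    qed (use R nrm_nonneg less_imp_le in \<open>auto intro!: always_eventually\<close>)
    then have "p f \<le> (\<Sum>n. p (u n))"
      using subadditive[OF f(1), of u] u summable by (simp add: sum_u)
    also have "\<dots> \<le> 2 * K"
      using suminf_le[of "\<lambda>n. p (u n)" "\<lambda>n. K * (1/2) ^ n"] u summable geometric by simp
    finally show ?thesis .
  qed
  show ?thesis
  proof (rule that[of "4 * K / r + 1"])
    show "4 * K / r + 1 > 0"
      using \<open>K \<ge> 0\<close> f0(2) by (simp add: add_nonneg_pos)
    fix f assume f: "f \<in> X"
    show "p f \<le> (4 * K / r + 1) * nrm f"
    proof (cases "f = (\<lambda>z. 0)")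
      case True
      then show ?thesis
        using scale[OF zero_mem, of 0] nrm_zero by simp
    next
      case False
      then have "nrm f > 0"
        using nrm_nonneg[OF f] nrm_eq_0[OF f] by simp
      define c where "c = r / (2 * nrm f)"
      have "c > 0"
        using \<open>nrm f > 0\<close> f0(2) by (simp add: c_def)
      then have "nrm (\<lambda>z. of_real c * f z) < r"
        using nrm_scale[OF f, of "of_real c"] \<open>nrm f > 0\<close> f0(2)
        by (simp add: c_def norm_divide norm_mult)
      from ball[OF scale_mem[OF f] this] have "c * p f \<le> 2 * K"
        using scale[OF f, of "of_real c"] \<open>c > 0\<close> by simp
      then have "p f \<le> 2 * K / c"
        using \<open>c > 0\<close> by (simp add: field_simps)
      also have "2 * K / c = 4 * K / r * nrm f"
        using f0(2) \<open>nrm f > 0\<close> by (simp add: c_def field_simps)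
      finally show ?thesis
        using \<open>nrm f > 0\<close> by (simp add: algebra_simps)
    qed
  qed
qed

lemma norm_null_imp_pointwise_null:
  assumes A1: "bounded_functional X nrm (point_eval z)"
    and h: "\<And>n::nat. h n \<in> X" "(\<lambda>n. nrm (h n)) \<longlonglongrightarrow> 0"
  shows "(\<lambda>n. h n z) \<longlonglongrightarrow> 0"
proof -
  have "\<exists>K. \<forall>f\<in>X. cmod (f z) \<le> K * nrm f"
    using A1 by (simp add: bounded_functional_def point_eval_def)
  then obtain K where K: "\<And>f. f \<in> X \<Longrightarrow> cmod (f z) \<le> K * nrm f"
    by metis
  show ?thesis
  proof (rule Lim_null_comparison)
    show "\<forall>\<^sub>F n in sequentially. cmod (h n z) \<le> K * nrm (h n)"
      using K[OF h(1)] by simp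
    show "(\<lambda>n. K * nrm (h n)) \<longlonglongrightarrow> 0"
      by (rule tendsto_mult_right_zero[OF h(2)])
  qed
qed

text \<open>
  The uniform boundedness principle for the point evaluations at a compact set: it applies because
  each single element of \<open>X\<close> is continuous. The seminorm is the maximum modulus over the set, with
  \<open>0\<close> inserted to cover the empty set.
\<close>

lemma point_evals_bounded_on_compact:
  assumes A1: "\<forall>z\<in>\<Omega>. bounded_functional X nrm (point_eval z)"
    and S: "compact S" "S \<subseteq> \<Omega>"
  obtains C :: real where "C > 0" "\<And>f z. f \<in> X \<Longrightarrow> z \<in> S \<Longrightarrow> cmod (f z) \<le> C * nrm f"
proof -
  define p where "p f = Sup (insert 0 ((\<lambda>z. cmod (f z)) ` S))" for f :: "complex \<Rightarrow> complex"
  have bdd: "bdd_above (insert 0 ((\<lambda>z. cmod (f z)) ` S))" if "f \<in> X" for f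
  proof -
    have "continuous_on S (\<lambda>z. cmod (f z))"
      using holomorphic[OF that] S(2)
      by (intro continuous_on_norm) (meson continuous_on_subset holomorphic_on_imp_continuous_on)
    then have "compact ((\<lambda>z. cmod (f z)) ` S)"
      using S(1) by (rule compact_continuous_image)
    then show ?thesis
      by (simp add: compact_imp_bounded bounded_imp_bdd_above)
  qed
  have upper: "cmod (f z) \<le> p f" if "f \<in> X" "z \<in> S" for f z
    unfolding p_def using that by (intro cSup_upper bdd) auto
  have nonneg: "0 \<le> p f" if "f \<in> X" for f
    unfolding p_def using that by (intro cSup_upper bdd) auto
  have least: "p f \<le> B" if "0 \<le> B" "\<And>z. z \<in> S \<Longrightarrow> cmod (f z) \<le> B" for f B
    unfolding p_def using that by (intro cSup_least) auto
  obtain C where C: "C > 0" "\<And>f. f \<in> X \<Longrightarrow> p f \<le> C * nrm f"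
  proof (rule countably_subadditive_seminorm_bounded[of p])
    show "0 \<le> p f" if "f \<in> X" for f
      using that by (rule nonneg)
    show "p (\<lambda>z. c * f z) = cmod c * p f" if f: "f \<in> X" for f c
    proof (rule antisym)
      show "p (\<lambda>z. c * f z) \<le> cmod c * p f"
        by (rule least) (auto simp: norm_mult f nonneg upper intro!: mult_left_mono)
      show "cmod c * p f \<le> p (\<lambda>z. c * f z)"
      proof (cases "c = 0")
        case True
        then show ?thesis
          using nonneg[OF scale_mem[OF f], of c] by simp
      next
        case False
        have "p f \<le> p (\<lambda>z. c * f z) / cmod c"
          using nonneg[OF scale_mem[OF f], of c] upper[OF scale_mem[OF f], of _ c] False
          by (intro least) (auto simp: norm_mult field_simps)
        then show ?thesis
          using False by (simp add: field_simps)
      qed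
    qed
    show "p (\<lambda>z. f z + g z) \<le> p f + p g" if "f \<in> X" "g \<in> X" for f g
    proof (rule least)
      show "0 \<le> p f + p g"
        using that by (simp add: nonneg)
      show "cmod (f z + g z) \<le> p f + p g" if z: "z \<in> S" for z
        using upper[OF \<open>f \<in> X\<close> z] upper[OF \<open>g \<in> X\<close> z] norm_triangle_ineq[of "f z" "g z"]
        by linarith
    qed
    show "p f \<le> (\<Sum>n. p (u n))"
      if f: "f \<in> X" and u: "\<And>n. u n \<in> X"
        and lim: "(\<lambda>n. nrm (\<lambda>z. f z - (\<Sum>j<n. u j z))) \<longlonglongrightarrow> 0"
        and summable: "summable (\<lambda>n. p (u n))" for f and u :: "nat \<Rightarrow> complex \<Rightarrow> complex"
    proof (rule least)
      show "0 \<le> (\<Sum>n. p (u n))"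
        using summable nonneg u by (simp add: suminf_nonneg)
      fix z assume z: "z \<in> S"
      have "(\<lambda>n. f z - (\<Sum>j<n. u j z)) \<longlonglongrightarrow> 0"
        using A1 S(2) z
        by (intro norm_null_imp_pointwise_null[of z "\<lambda>n z. f z - (\<Sum>j<n. u j z)"]
            diff_mem f sum_mem u lim) auto
      then have "(\<lambda>n. cmod (f z - (\<Sum>j<n. u j z)) + (\<Sum>n. p (u n))) \<longlonglongrightarrow> 0 + (\<Sum>n. p (u n))"
        by (intro tendsto_add tendsto_const) (simp add: tendsto_norm_zero)
      moreover have "cmod (f z) \<le> cmod (f z - (\<Sum>j<n. u j z)) + (\<Sum>n. p (u n))" for n
      proof -
        have "cmod (\<Sum>j<n. u j z) \<le> (\<Sum>j<n. p (u j))"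
          using upper[OF u z] by (rule sum_norm_le)
        also have "\<dots> \<le> (\<Sum>n. p (u n))"
          using summable nonneg u by (intro sum_le_suminf) auto
        finally show ?thesis
          using norm_triangle_ineq[of "f z - (\<Sum>j<n. u j z)" "\<Sum>j<n. u j z"] by simp
      qed
      ultimately show "cmod (f z) \<le> (\<Sum>n. p (u n))"
        using LIMSEQ_le_const by fastforce
    qed
  qed (rule that)
  show ?thesis
  proof (rule that[OF C(1)])
    show "cmod (f z) \<le> C * nrm f" if "f \<in> X" "z \<in> S" for f z
      using upper[OF that] C(2)[OF that(1)] by linarith
  qed
qed

text \<open>
  The closed graph argument: norm convergence implies pointwise convergence, so a weighted
  composition operator commutes with every sum that makes sense on both sides. Multipliers
  (\<open>\<phi> z = z\<close>) are a special case.
\<close>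

lemma weighted_comp_op_automatically_bounded:
  assumes A1: "\<forall>z\<in>\<Omega>. bounded_functional X nrm (point_eval z)"
    and \<phi>: "\<phi> ` \<Omega> \<subseteq> \<Omega>"
    and maps: "\<And>f. f \<in> X \<Longrightarrow> weighted_comp_op \<Omega> F \<phi> f \<in> X"
  shows "bounded_operator X nrm (weighted_comp_op \<Omega> F \<phi>)"
proof -
  let ?T = "weighted_comp_op \<Omega> F \<phi>"
  have add: "?T (\<lambda>z. f z + g z) = (\<lambda>z. ?T f z + ?T g z)" for f g
    by (auto simp: weighted_comp_op_def restrict0_def algebra_simps)
  have mult: "?T (\<lambda>z. c * f z) = (\<lambda>z. c * ?T f z)" for f c
    by (auto simp: weighted_comp_op_def restrict0_def)
  obtain C where "C > 0" and C: "\<And>f. f \<in> X \<Longrightarrow> nrm (?T f) \<le> C * nrm f"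
  proof (rule countably_subadditive_seminorm_bounded[of "\<lambda>f. nrm (?T f)"])
    show "nrm (?T f) \<le> (\<Sum>n. nrm (?T (u n)))"
      if f: "f \<in> X" and u: "\<And>n. u n \<in> X"
        and lim: "(\<lambda>n. nrm (\<lambda>z. f z - (\<Sum>j<n. u j z))) \<longlonglongrightarrow> 0"
        and summable: "summable (\<lambda>n. nrm (?T (u n)))" for f and u :: "nat \<Rightarrow> complex \<Rightarrow> complex"
    proof -
      obtain g where g: "g \<in> X" "(\<lambda>n. nrm (\<lambda>z. g z - (\<Sum>j<n. ?T (u j) z))) \<longlonglongrightarrow> 0"
        "nrm g \<le> (\<Sum>n. nrm (?T (u n)))"
        using absolutely_convergent_series[of "\<lambda>n. ?T (u n)", OF maps[OF u] summable] .
      have "g z = ?T f z" for z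
      proof (cases "z \<in> \<Omega>")
        case True
        then have "\<phi> z \<in> \<Omega>"
          using \<phi> by blast
        then have "(\<lambda>n. f (\<phi> z) - (\<Sum>j<n. u j (\<phi> z))) \<longlonglongrightarrow> 0"
          using A1
          by (intro norm_null_imp_pointwise_null[of "\<phi> z" "\<lambda>n z. f z - (\<Sum>j<n. u j z)"]
              diff_mem f sum_mem u lim) auto
        then have "(\<lambda>n. F z * (f (\<phi> z) - (\<Sum>j<n. u j (\<phi> z)))) \<longlonglongrightarrow> 0"
          by (rule tendsto_mult_right_zero)
        then have "(\<lambda>n. ?T f z - (\<Sum>j<n. ?T (u j) z)) \<longlonglongrightarrow> 0"
          using True by (simp add: weighted_comp_op_def restrict0_def algebra_simps sum_distrib_left)
        moreover have "(\<lambda>n. g z - (\<Sum>j<n. ?T (u j) z)) \<longlonglongrightarrow> 0"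
          using A1 True
          by (intro norm_null_imp_pointwise_null[of z "\<lambda>n z. g z - (\<Sum>j<n. ?T (u j) z)"]
              diff_mem g sum_mem maps u) auto
        ultimately have "(\<lambda>n. (g z - (\<Sum>j<n. ?T (u j) z)) - (?T f z - (\<Sum>j<n. ?T (u j) z)))
            \<longlonglongrightarrow> 0 - 0"
          by (intro tendsto_diff)
        then show ?thesis
          by (simp add: LIMSEQ_const_iff)
      next
        case False
        then show ?thesis
          using zero_outside[OF g(1)] by (simp add: weighted_comp_op_def restrict0_def)
      qed
      then have "g = ?T f" ..
      with g(3) show ?thesis by simp
    qed
    show "0 \<le> nrm (?T f)" if "f \<in> X" for f
      by (rule nrm_nonneg[OF maps[OF that]])
    show "nrm (?T (\<lambda>z. c * f z)) = cmod c * nrm (?T f)" if "f \<in> X" for f c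
      unfolding mult by (rule nrm_scale[OF maps[OF that]])
    show "nrm (?T (\<lambda>z. f z + g z)) \<le> nrm (?T f) + nrm (?T g)" if "f \<in> X" "g \<in> X" for f g
      unfolding add by (rule nrm_triangle[OF maps maps]) (use that in auto)
  qed (rule that)
  then show ?thesis
    unfolding bounded_operator_def using add mult maps by blast
qed

section \<open>Surjectivity of the operator and bijectivity of the composition symbol\<close>

text \<open>
  Boundedness of the evaluation ensures that the supremum defining its norm is a genuine one and
  not the default value of \<open>Sup\<close> on an unbounded set.
\<close>

lemma functional_norm_point_eval_pos:
  assumes A1: "bounded_functional X nrm (point_eval z)"
    and f: "f \<in> X" "f z \<noteq> 0"
  shows "functional_norm X nrm (point_eval z) > 0"
proof -
  have "\<exists>K. \<forall>f\<in>X. cmod (f z) \<le> K * nrm f"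
    using A1 by (simp add: bounded_functional_def point_eval_def)
  then obtain K where K: "\<And>f. f \<in> X \<Longrightarrow> cmod (f z) \<le> K * nrm f"
    by metis
  have "nrm f > 0"
    using f nrm_nonneg[OF f(1)] nrm_eq_0[OF f(1)] by fastforce
  define g where "g = (\<lambda>z. of_real (1 / nrm f) * f z)"
  have g: "g \<in> X" "nrm g = 1" "cmod (g z) > 0"
    using scale_mem[OF f(1), of "of_real (1 / nrm f)"]
      nrm_scale[OF f(1), of "of_real (1 / nrm f)"] \<open>nrm f > 0\<close> f(2)
    by (auto simp: g_def norm_divide)
  have "bdd_above {cmod (h z) |h. h \<in> X \<and> nrm h \<le> 1}"
  proof (rule bdd_aboveI[of _ "\<bar>K\<bar>"])
    fix x assume "x \<in> {cmod (h z) |h. h \<in> X \<and> nrm h \<le> 1}"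
    then obtain h where h: "x = cmod (h z)" "h \<in> X" "nrm h \<le> 1" by auto
    have "K * nrm h \<le> \<bar>K\<bar> * 1"
      using h(3) nrm_nonneg[OF h(2)] by (intro mult_mono) auto
    with K[OF h(2)] h(1) show "x \<le> \<bar>K\<bar>" by simp
  qed
  then have "cmod (g z) \<le> functional_norm X nrm (point_eval z)"
    unfolding functional_norm_def point_eval_def
    using g by (intro cSup_upper) auto
  with g(3) show ?thesis by linarith
qed

lemma functional_norm_point_eval_le:
  assumes "C \<ge> 0" and bound: "\<And>f. f \<in> X \<Longrightarrow> cmod (f z) \<le> C * nrm f"
  shows "functional_norm X nrm (point_eval z) \<le> C"
  unfolding functional_norm_def point_eval_def
proof (rule cSup_least)
  show "{cmod (f z) |f. f \<in> X \<and> nrm f \<le> 1} \<noteq> {}"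
    using zero_mem nrm_zero by force
  fix x assume "x \<in> {cmod (f z) |f. f \<in> X \<and> nrm f \<le> 1}"
  then obtain f where f: "x = cmod (f z)" "f \<in> X" "nrm f \<le> 1" by auto
  have "C * nrm f \<le> C * 1"
    using f(3) \<open>C \<ge> 0\<close> by (intro mult_left_mono)
  with bound[OF f(2)] f(1) show "x \<le> C" by simp
qed

text \<open>
  All functions in the range of \<open>T\<close> satisfy \<open>g a / F a = g b / F b\<close> when \<open>\<phi> a = \<phi> b\<close>; for
  \<open>g z = 1\<close> this yields \<open>F a = F b\<close>, and then \<open>g z = z\<close> yields \<open>a = b\<close>.
\<close>

lemma surj_weighted_comp_op_imp_nonzero_inj:
  assumes one: "restrict0 \<Omega> (\<lambda>z. 1) \<in> X" and ident: "restrict0 \<Omega> (\<lambda>z. z) \<in> X"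
    and surj: "\<And>g. g \<in> X \<Longrightarrow> \<exists>f\<in>X. weighted_comp_op \<Omega> F \<phi> f = g"
  shows "\<forall>z\<in>\<Omega>. F z \<noteq> 0" and "inj_on \<phi> \<Omega>"
proof -
  obtain f1 where f1: "weighted_comp_op \<Omega> F \<phi> f1 = restrict0 \<Omega> (\<lambda>z. 1)"
    using surj[OF one] by blast
  obtain f2 where f2: "weighted_comp_op \<Omega> F \<phi> f2 = restrict0 \<Omega> (\<lambda>z. z)"
    using surj[OF ident] by blast
  have eq1: "F z * f1 (\<phi> z) = 1" if "z \<in> \<Omega>" for z
    using fun_cong[OF f1, of z] that by (simp add: weighted_comp_op_def restrict0_def)
  have eq2: "F z * f2 (\<phi> z) = z" if "z \<in> \<Omega>" for z
    using fun_cong[OF f2, of z] that by (simp add: weighted_comp_op_def restrict0_def)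
  show "\<forall>z\<in>\<Omega>. F z \<noteq> 0"
    using eq1 by fastforce
  show "inj_on \<phi> \<Omega>"
  proof (rule inj_onI)
    fix a b assume ab: "a \<in> \<Omega>" "b \<in> \<Omega>" "\<phi> a = \<phi> b"
    then have "F a * f1 (\<phi> a) = F b * f1 (\<phi> a)" "f1 (\<phi> a) \<noteq> 0"
      using eq1[of a] eq1[of b] by auto
    then have "F a = F b" by simp
    then show "a = b"
      using eq2[OF ab(1)] eq2[OF ab(2)] ab(3) by metis
  qed
qed

end

text \<open>
  If the open image \<open>\<phi> ` \<Omega>\<close> misses a point of the connected set \<open>\<Omega>\<close>, it has a boundary point \<open>w\<close>
  in \<open>\<Omega>\<close>. Points whose images tend to \<open>w\<close> cannot accumulate inside \<open>\<Omega>\<close>, as \<open>w\<close> would then be a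
  value of \<open>\<phi>\<close>; since \<open>\<Omega>\<close> is bounded, they approach its frontier.
\<close>

lemma non_surjective_self_map_near_frontier:
  fixes \<phi> :: "complex \<Rightarrow> complex"
  assumes domain: "open \<Omega>" "connected \<Omega>" "bounded \<Omega>"
    and \<phi>: "continuous_on \<Omega> \<phi>" "\<phi> ` \<Omega> \<subseteq> \<Omega>" "open (\<phi> ` \<Omega>)" "\<phi> ` \<Omega> \<noteq> \<Omega>"
  obtains w where "w \<in> \<Omega>"
    "\<And>\<delta> e. \<delta> > 0 \<Longrightarrow> e > 0 \<Longrightarrow> \<exists>z\<in>\<Omega>. infdist z (frontier \<Omega>) < \<delta> \<and> dist (\<phi> z) w < e"
proof -
  have "\<Omega> \<noteq> {}"
    using \<phi>(4) by auto
  have "\<exists>w\<in>\<Omega>. w \<in> closure (\<phi> ` \<Omega>) \<and> w \<notin> \<phi> ` \<Omega>"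
  proof (rule ccontr)
    assume "\<not> ?thesis"
    then have "\<Omega> \<subseteq> \<phi> ` \<Omega> \<union> - closure (\<phi> ` \<Omega>)" by blast
    moreover have "\<phi> ` \<Omega> \<inter> - closure (\<phi> ` \<Omega>) \<inter> \<Omega> = {}"
      using closure_subset[of "\<phi> ` \<Omega>"] by blast
    moreover have "\<phi> ` \<Omega> \<inter> \<Omega> \<noteq> {}"
      using \<phi>(2) \<open>\<Omega> \<noteq> {}\<close> by blast
    moreover have "- closure (\<phi> ` \<Omega>) \<inter> \<Omega> \<noteq> {}"
      using calculation(1) \<phi>(2,4) by blast
    ultimately show False
      using connectedD[OF domain(2) \<phi>(3), of "- closure (\<phi> ` \<Omega>)"] by auto
  qed
  then obtain w where w: "w \<in> \<Omega>" "w \<in> closure (\<phi> ` \<Omega>)" "w \<notin> \<phi> ` \<Omega>" by blast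
  from w(2) obtain x where x: "\<And>n::nat. x n \<in> \<phi> ` \<Omega>" "x \<longlonglongrightarrow> w"
    unfolding closure_sequential by blast
  have "\<exists>z. z \<in> \<Omega> \<and> \<phi> z = x n" for n
    using x(1)[of n] by auto
  then obtain z where z: "\<And>n. z n \<in> \<Omega>" "\<And>n. \<phi> (z n) = x n" by metis
  have "compact (closure \<Omega>)"
    using domain(3) by (simp add: compact_closure)
  moreover have "\<forall>n. z n \<in> closure \<Omega>"
    using z(1) closure_subset by blast
  ultimately obtain l r where l: "l \<in> closure \<Omega>" "strict_mono r" "(z \<circ> r) \<longlonglongrightarrow> l"
    unfolding compact_def by blast
  have xr: "(\<lambda>n. \<phi> ((z \<circ> r) n)) \<longlonglongrightarrow> w"
    using LIMSEQ_subseq_LIMSEQ[OF x(2) l(2)] z(2) by (simp add: o_def)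
  have "l \<notin> \<Omega>"
  proof
    assume "l \<in> \<Omega>"
    then have "(\<lambda>n. \<phi> ((z \<circ> r) n)) \<longlonglongrightarrow> \<phi> l"
      using continuous_on_tendsto_compose[OF \<phi>(1) l(3)] z(1) by simp
    then show False
      using LIMSEQ_unique[OF xr] w(3) \<open>l \<in> \<Omega>\<close> by blast
  qed
  then have "l \<in> frontier \<Omega>"
    using l(1) domain(1) by (simp add: frontier_def interior_open)
  show ?thesis
  proof (rule that[OF w(1)])
    fix \<delta> e :: real assume "\<delta> > 0" "e > 0"
    then have "eventually (\<lambda>n. dist ((z \<circ> r) n) l < \<delta> \<and> dist (\<phi> ((z \<circ> r) n)) w < e) sequentially"
      using l(3) xr by (intro eventually_conj) (auto dest: tendstoD)
    then obtain n where n: "dist (z (r n)) l < \<delta>" "dist (\<phi> (z (r n))) w < e"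
      by (auto dest: eventually_happens)
    have "infdist (z (r n)) (frontier \<Omega>) < \<delta>"
      using infdist_le[OF \<open>l \<in> frontier \<Omega>\<close>, of "z (r n)"] n(1) by linarith
    then show "\<exists>z\<in>\<Omega>. infdist z (frontier \<Omega>) < \<delta> \<and> dist (\<phi> z) w < e"
      using z(1) n(2) by blast
  qed
qed

context banach_space_of_analytic_functions
begin

text \<open>
  For \<open>g = T (S g)\<close> one has \<open>g z = F z * S g (\<phi> z)\<close>. If \<open>\<phi> z\<close> stays in a compact set, the second
  factor is at most a constant times \<open>nrm g\<close>, so the norm of the evaluation at \<open>z\<close> is at most a
  constant times \<open>cmod (F z)\<close>. Since \<open>F = T 1\<close> belongs to \<open>X\<close>, axiom A4 forbids this for
  \<open>z\<close> near the frontier.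
\<close>

lemma invertible_weighted_comp_op_imp_surj_symbol:
  assumes domain: "open \<Omega>" "connected \<Omega>" "bounded \<Omega>"
    and A1: "\<forall>z\<in>\<Omega>. bounded_functional X nrm (point_eval z)"
    and A2: "restrict0 \<Omega> (\<lambda>z. 1) \<in> X"
    and A4: "\<forall>f\<in>X. \<forall>\<epsilon>>0. \<exists>\<delta>>0. \<forall>z\<in>\<Omega>. infdist z (frontier \<Omega>) < \<delta> \<longrightarrow>
               cmod (f z) / functional_norm X nrm (point_eval z) < \<epsilon>"
    and \<phi>: "\<phi> holomorphic_on \<Omega>" "\<phi> ` \<Omega> \<subseteq> \<Omega>" "inj_on \<phi> \<Omega>"
    and T: "bounded_operator X nrm (weighted_comp_op \<Omega> F \<phi>)"
    and S: "inverse_operator X nrm (weighted_comp_op \<Omega> F \<phi>) S"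
  shows "\<phi> ` \<Omega> = \<Omega>"
proof (rule ccontr)
  assume "\<phi> ` \<Omega> \<noteq> \<Omega>"
  then obtain w where w: "w \<in> \<Omega>"
    and near: "\<And>\<delta> e. \<delta> > 0 \<Longrightarrow> e > 0 \<Longrightarrow>
      \<exists>z\<in>\<Omega>. infdist z (frontier \<Omega>) < \<delta> \<and> dist (\<phi> z) w < e"
    using non_surjective_self_map_near_frontier[OF domain, of \<phi>] \<phi>
      open_mapping_thm3[OF \<phi>(1) domain(1) \<phi>(3)] holomorphic_on_imp_continuous_on by metis
  obtain e where e: "e > 0" "cball w e \<subseteq> \<Omega>"
    using w domain(1) open_contains_cball by blast
  obtain C where C: "C > 0" "\<And>f z. f \<in> X \<Longrightarrow> z \<in> cball w e \<Longrightarrow> cmod (f z) \<le> C * nrm f"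
    using point_evals_bounded_on_compact[OF A1 compact_cball e(2)] by blast
  obtain K where K: "\<And>f. f \<in> X \<Longrightarrow> S f \<in> X \<and> nrm (S f) \<le> K * nrm f \<and>
      weighted_comp_op \<Omega> F \<phi> (S f) = f"
    using S unfolding inverse_operator_def bounded_operator_def by blast
  define c where "c = C * \<bar>K\<bar> + 1"
  have "c > 0"
    using C(1) by (simp add: c_def add_nonneg_pos)
  let ?F = "weighted_comp_op \<Omega> F \<phi> (restrict0 \<Omega> (\<lambda>z. 1))"
  have "?F \<in> X"
    using T A2 by (simp add: bounded_operator_def)
  then obtain \<delta> where \<delta>: "\<delta> > 0" "\<And>z. z \<in> \<Omega> \<Longrightarrow> infdist z (frontier \<Omega>) < \<delta> \<Longrightarrow>
      cmod (?F z) / functional_norm X nrm (point_eval z) < 1 / c"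
    using A4 \<open>c > 0\<close> by (meson zero_less_divide_1_iff)
  obtain z where z: "z \<in> \<Omega>" "infdist z (frontier \<Omega>) < \<delta>" "dist (\<phi> z) w < e"
    using near[OF \<delta>(1) e(1)] by blast
  then have "\<phi> z \<in> \<Omega>" "\<phi> z \<in> cball w e"
    using \<phi>(2) by (auto simp: dist_commute)
  have Fz: "?F z = F z"
    using z(1) \<open>\<phi> z \<in> \<Omega>\<close> by (simp add: weighted_comp_op_def restrict0_def)
  have bound: "cmod (g z) \<le> (cmod (F z) * c) * nrm g" if g: "g \<in> X" for g
  proof -
    have "cmod (S g (\<phi> z)) \<le> C * nrm (S g)"
      using C(2) K[OF g] \<open>\<phi> z \<in> cball w e\<close> by blast
    also have "\<dots> \<le> C * (\<bar>K\<bar> * nrm g)"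
      using K[OF g] C(1) nrm_nonneg[OF g]
      by (intro mult_left_mono) (auto intro: order_trans[OF _ mult_right_mono[OF abs_ge_self]])
    also have "\<dots> \<le> c * nrm g"
      using nrm_nonneg[OF g] by (simp add: c_def algebra_simps)
    finally have "cmod (F z) * cmod (S g (\<phi> z)) \<le> cmod (F z) * (c * nrm g)"
      by (intro mult_left_mono) auto
    moreover have "weighted_comp_op \<Omega> F \<phi> (S g) z = g z"
      using K[OF g] by simp
    then have "g z = F z * S g (\<phi> z)"
      using z(1) by (simp add: weighted_comp_op_def restrict0_def)
    ultimately show ?thesis
      by (simp add: norm_mult mult.assoc)
  qed
  let ?N = "functional_norm X nrm (point_eval z)"
  have "?N \<le> cmod (F z) * c"
    using bound \<open>c > 0\<close> by (intro functional_norm_point_eval_le) auto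
  moreover have "?N > 0"
    using A1 z(1) A2 by (intro functional_norm_point_eval_pos) (auto simp: restrict0_def)
  ultimately have "1 / c \<le> cmod (F z) / ?N"
    using \<open>c > 0\<close> by (simp add: field_simps)
  then show False
    using \<delta>(2)[OF z(1,2)] Fz by simp
qed

section \<open>The inverse operator\<close>

lemma weighted_comp_op_inverse_symbols:
  assumes \<phi>: "bij_betw \<phi> \<Omega> \<Omega>" and F: "\<forall>z\<in>\<Omega>. F z \<noteq> 0" and f: "f \<in> X"
  defines "\<psi> \<equiv> inv_into \<Omega> \<phi>"
  defines "G \<equiv> \<lambda>z. 1 / F (\<psi> z)"
  shows "weighted_comp_op \<Omega> G \<psi> (weighted_comp_op \<Omega> F \<phi> f) = f"
    and "weighted_comp_op \<Omega> F \<phi> (weighted_comp_op \<Omega> G \<psi> f) = f"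
proof -
  have \<psi>: "\<psi> z \<in> \<Omega>" "\<phi> (\<psi> z) = z" "\<phi> z \<in> \<Omega>" "\<psi> (\<phi> z) = z" if "z \<in> \<Omega>" for z
    using that \<phi> bij_betw_inv_into_left[OF \<phi> that] bij_betw_inv_into_right[OF \<phi> that]
      bij_betwE[OF bij_betw_inv_into[OF \<phi>]] bij_betwE[OF \<phi>]
    by (auto simp: \<psi>_def)
  show "weighted_comp_op \<Omega> G \<psi> (weighted_comp_op \<Omega> F \<phi> f) = f"
    "weighted_comp_op \<Omega> F \<phi> (weighted_comp_op \<Omega> G \<psi> f) = f"
    using F \<psi> zero_outside[OF f]
    by (auto simp: weighted_comp_op_def restrict0_def G_def fun_eq_iff)
qed

end

lemma automorphism_inv_into:
  assumes "open \<Omega>" and \<phi>: "automorphism \<Omega> \<phi>"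
  shows "automorphism \<Omega> (inv_into \<Omega> \<phi>)"
proof -
  have bij: "bij_betw \<phi> \<Omega> \<Omega>" and hol: "\<phi> holomorphic_on \<Omega>"
    using \<phi> by (auto simp: automorphism_def)
  then have inj: "inj_on \<phi> \<Omega>" and img: "\<phi> ` \<Omega> = \<Omega>"
    by (auto simp: bij_betw_def)
  obtain g where g: "g holomorphic_on \<phi> ` \<Omega>" "\<And>z. z \<in> \<Omega> \<Longrightarrow> g (\<phi> z) = z"
    using holomorphic_has_inverse[OF hol assms(1) inj] by metis
  have "g z = inv_into \<Omega> \<phi> z" if "z \<in> \<Omega>" for z
    using g(2)[of "inv_into \<Omega> \<phi> z"] that img by (metis f_inv_into_f inv_into_into)
  then have "inv_into \<Omega> \<phi> holomorphic_on \<Omega>"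
    using g(1) img holomorphic_cong[OF refl] by metis
  with bij_betw_inv_into[OF bij] show ?thesis
    by (simp add: automorphism_def)
qed

lemma wco_symbols_inverse:
  assumes "open \<Omega>" and \<phi>: "automorphism \<Omega> \<phi>"
    and F: "F holomorphic_on \<Omega>" "\<forall>z\<in>\<Omega>. F z \<noteq> 0"
  shows "wco_symbols \<Omega> (\<lambda>z. 1 / F (inv_into \<Omega> \<phi> z)) (inv_into \<Omega> \<phi>)"
proof -
  have hol: "inv_into \<Omega> \<phi> holomorphic_on \<Omega>" and img: "inv_into \<Omega> \<phi> ` \<Omega> = \<Omega>"
    using automorphism_inv_into[OF assms(1,2)] by (auto simp: automorphism_def bij_betw_def)
  have "(F \<circ> inv_into \<Omega> \<phi>) holomorphic_on \<Omega>"
    using holomorphic_on_compose[OF hol] F(1) img by simp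
  then have "(\<lambda>z. 1 / F (inv_into \<Omega> \<phi> z)) holomorphic_on \<Omega>"
    using F(2) img by (intro holomorphic_on_divide) (auto simp: o_def)
  then show ?thesis
    using hol img by (simp add: wco_symbols_def)
qed

context banach_space_of_analytic_functions
begin

text \<open>
  When composition operators with automorphisms act on \<open>X\<close>, multiplying by \<open>F\<close> amounts to
  composing with the inverse automorphism and then applying \<open>T\<close>.
\<close>

lemma multiplier_if_weighted_comp_op:
  assumes "open \<Omega>"
    and A5: "\<forall>\<alpha>. automorphism \<Omega> \<alpha> \<longrightarrow> bounded_operator X nrm (comp_op \<Omega> \<alpha>)"
    and F: "F holomorphic_on \<Omega>" and \<phi>: "automorphism \<Omega> \<phi>"
    and T: "\<And>f. f \<in> X \<Longrightarrow> weighted_comp_op \<Omega> F \<phi> f \<in> X"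
  shows "F \<in> multipliers \<Omega> X"
proof -
  let ?\<psi> = "inv_into \<Omega> \<phi>"
  have bij: "bij_betw \<phi> \<Omega> \<Omega>"
    using \<phi> by (simp add: automorphism_def)
  have "(\<lambda>z. F z * f z) \<in> X" if f: "f \<in> X" for f
  proof -
    have "comp_op \<Omega> ?\<psi> f \<in> X"
      using A5 automorphism_inv_into[OF assms(1) \<phi>] f by (simp add: bounded_operator_def)
    moreover have "weighted_comp_op \<Omega> F \<phi> (comp_op \<Omega> ?\<psi> f) = (\<lambda>z. F z * f z)"
      using bij_betwE[OF bij] bij_betw_inv_into_left[OF bij] zero_outside[OF f]
      by (auto simp: weighted_comp_op_def comp_op_def restrict0_def fun_eq_iff)
    ultimately show ?thesis
      using T by metis
  qed
  with F show ?thesis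
    by (simp add: multipliers_def)
qed

text \<open>
  Since \<open>T_{G,\<psi>}\<close> is division by \<open>F\<close> followed by composition with \<open>\<phi>\<^sup>-\<^sup>1\<close>, it maps \<open>X\<close> into
  itself, and such an operator is automatically bounded.
\<close>

lemma inverse_weighted_comp_op_if_multiplier:
  assumes "open \<Omega>"
    and A1: "\<forall>z\<in>\<Omega>. bounded_functional X nrm (point_eval z)"
    and A5: "\<forall>\<alpha>. automorphism \<Omega> \<alpha> \<longrightarrow> bounded_operator X nrm (comp_op \<Omega> \<alpha>)"
    and \<phi>: "automorphism \<Omega> \<phi>" and F: "\<forall>z\<in>\<Omega>. F z \<noteq> 0"
    and mult: "(\<lambda>z. 1 / F z) \<in> multipliers \<Omega> X"
  defines "\<psi> \<equiv> inv_into \<Omega> \<phi>"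
  shows "inverse_operator X nrm (weighted_comp_op \<Omega> F \<phi>)
    (weighted_comp_op \<Omega> (\<lambda>z. 1 / F (\<psi> z)) \<psi>)"
proof -
  have \<psi>: "automorphism \<Omega> \<psi>"
    unfolding \<psi>_def using assms(1) \<phi> by (rule automorphism_inv_into)
  have "weighted_comp_op \<Omega> (\<lambda>z. 1 / F (\<psi> z)) \<psi> f \<in> X" if "f \<in> X" for f
  proof -
    have "(\<lambda>z. 1 / F z * f z) \<in> X"
      using mult that by (simp add: multipliers_def)
    then have "comp_op \<Omega> \<psi> (\<lambda>z. 1 / F z * f z) \<in> X"
      using A5 \<psi> by (simp add: bounded_operator_def)
    moreover have "comp_op \<Omega> \<psi> (\<lambda>z. 1 / F z * f z) = weighted_comp_op \<Omega> (\<lambda>z. 1 / F (\<psi> z)) \<psi> f"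
      by (simp add: comp_op_def weighted_comp_op_def o_def)
    ultimately show ?thesis by simp
  qed
  moreover have "\<psi> ` \<Omega> \<subseteq> \<Omega>"
    using \<psi> by (simp add: automorphism_def bij_betw_def)
  ultimately have "bounded_operator X nrm (weighted_comp_op \<Omega> (\<lambda>z. 1 / F (\<psi> z)) \<psi>)"
    using weighted_comp_op_automatically_bounded[OF A1] by blast
  moreover have "bij_betw \<phi> \<Omega> \<Omega>"
    using \<phi> by (simp add: automorphism_def)
  ultimately show ?thesis
    unfolding inverse_operator_def \<psi>_def
    using weighted_comp_op_inverse_symbols[OF _ F] by blast
qed

text \<open>
  The equation \<open>T (S f) = f\<close> says that \<open>f / F\<close> is \<open>S f\<close> composed with \<open>\<phi>\<close>, and by A5 composition
  with \<open>\<phi>\<close> does not leave \<open>X\<close>.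
\<close>

lemma multiplier_if_inverse:
  assumes "open \<Omega>"
    and A5: "\<forall>\<alpha>. automorphism \<Omega> \<alpha> \<longrightarrow> bounded_operator X nrm (comp_op \<Omega> \<alpha>)"
    and \<phi>: "automorphism \<Omega> \<phi>" and F: "F holomorphic_on \<Omega>" "\<forall>z\<in>\<Omega>. F z \<noteq> 0"
    and S: "inverse_operator X nrm (weighted_comp_op \<Omega> F \<phi>) S"
  shows "(\<lambda>z. 1 / F z) \<in> multipliers \<Omega> X"
proof -
  have "(\<lambda>z. 1 / F z * f z) \<in> X" if f: "f \<in> X" for f
  proof -
    have Sf: "S f \<in> X" "weighted_comp_op \<Omega> F \<phi> (S f) = f"
      using S f by (auto simp: inverse_operator_def bounded_operator_def)
    have "comp_op \<Omega> \<phi> (S f) z = 1 / F z * f z" for z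
      using fun_cong[OF Sf(2), of z] F(2) zero_outside[OF f]
      by (auto simp: comp_op_def weighted_comp_op_def restrict0_def field_simps split: if_splits)
    then have "comp_op \<Omega> \<phi> (S f) = (\<lambda>z. 1 / F z * f z)" ..
    moreover have "comp_op \<Omega> \<phi> (S f) \<in> X"
      using A5 \<phi> Sf(1) by (simp add: bounded_operator_def)
    ultimately show ?thesis by simp
  qed
  moreover have "(\<lambda>z. 1 / F z) holomorphic_on \<Omega>"
    using F by (intro holomorphic_on_divide) auto
  ultimately show ?thesis
    by (simp add: multipliers_def)
qed

end

theorem theorem8:
  fixes \<Omega> :: "complex set" and X :: "(complex \<Rightarrow> complex) set"
    and nrm :: "(complex \<Rightarrow> complex) \<Rightarrow> real" and F \<phi> :: "complex \<Rightarrow> complex"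
  assumes domain: "open \<Omega>" "connected \<Omega>" "bounded \<Omega>"
    and X: "banach_space_of_analytic_functions \<Omega> X nrm"
    and A1: "\<forall>z\<in>\<Omega>. bounded_functional X nrm (point_eval z)"
    and A2: "restrict0 \<Omega> (\<lambda>z. 1) \<in> X"
    and A3: "bounded_operator X nrm (\<lambda>f z. z * f z)"
    and A4: "\<forall>f\<in>X. \<forall>\<epsilon>>0. \<exists>\<delta>>0. \<forall>z\<in>\<Omega>. infdist z (frontier \<Omega>) < \<delta> \<longrightarrow>
               cmod (f z) / functional_norm X nrm (point_eval z) < \<epsilon>"
    and symbols: "wco_symbols \<Omega> F \<phi>"
    and bounded: "bounded_operator X nrm (weighted_comp_op \<Omega> F \<phi>)"
  shows "(invertible_operator X nrm (weighted_comp_op \<Omega> F \<phi>) \<longrightarrow>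
            automorphism \<Omega> \<phi> \<and> (\<forall>z\<in>\<Omega>. F z \<noteq> 0)) \<and>
         ((\<forall>\<alpha>. automorphism \<Omega> \<alpha> \<longrightarrow> bounded_operator X nrm (comp_op \<Omega> \<alpha>)) \<longrightarrow>
            (invertible_operator X nrm (weighted_comp_op \<Omega> F \<phi>) \<longleftrightarrow>
               automorphism \<Omega> \<phi> \<and> (\<forall>z\<in>\<Omega>. F z \<noteq> 0) \<and>
               (\<lambda>z. 1 / F z) \<in> multipliers \<Omega> X) \<and>
            (invertible_operator X nrm (weighted_comp_op \<Omega> F \<phi>) \<longrightarrow>
               F \<in> multipliers \<Omega> X \<and>
               (let \<psi> = inv_into \<Omega> \<phi>; G = (\<lambda>z. 1 / F (\<psi> z))
                in wco_symbols \<Omega> G \<psi> \<and>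
                   inverse_operator X nrm (weighted_comp_op \<Omega> F \<phi>)
                     (weighted_comp_op \<Omega> G \<psi>))))"
proof -
  interpret banach_space_of_analytic_functions \<Omega> X nrm by (rule X)
  let ?T = "weighted_comp_op \<Omega> F \<phi>"
  have F: "F holomorphic_on \<Omega>" and \<phi>: "\<phi> holomorphic_on \<Omega>" "\<phi> ` \<Omega> \<subseteq> \<Omega>"
    using symbols by (auto simp: wco_symbols_def)
  have "(\<lambda>z. z * restrict0 \<Omega> (\<lambda>z. 1) z) \<in> X"
    using A2 A3 by (simp add: bounded_operator_def)
  moreover have "(\<lambda>z. z * restrict0 \<Omega> (\<lambda>z. 1) z) = restrict0 \<Omega> (\<lambda>z. z)"
    by (auto simp: restrict0_def)
  ultimately have ident: "restrict0 \<Omega> (\<lambda>z. z) \<in> X" by simp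
  have a: "automorphism \<Omega> \<phi> \<and> (\<forall>z\<in>\<Omega>. F z \<noteq> 0)" if inv: "invertible_operator X nrm ?T"
  proof -
    obtain S where S: "inverse_operator X nrm ?T S"
      using inv by (auto simp: invertible_operator_def)
    then have surj: "\<exists>f\<in>X. ?T f = g" if "g \<in> X" for g
      using that unfolding inverse_operator_def bounded_operator_def by blast
    note sym = surj_weighted_comp_op_imp_nonzero_inj[OF A2 ident surj]
    have "\<phi> ` \<Omega> = \<Omega>"
      using invertible_weighted_comp_op_imp_surj_symbol[OF domain A1 A2 A4 \<phi> sym(2) bounded S] .
    with sym \<phi>(1) show ?thesis
      by (simp add: automorphism_def bij_betw_def)
  qed
  have b: "(invertible_operator X nrm ?T \<longleftrightarrow>
        automorphism \<Omega> \<phi> \<and> (\<forall>z\<in>\<Omega>. F z \<noteq> 0) \<and> (\<lambda>z. 1 / F z) \<in> multipliers \<Omega> X) \<and>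
      (invertible_operator X nrm ?T \<longrightarrow> F \<in> multipliers \<Omega> X \<and>
        wco_symbols \<Omega> (\<lambda>z. 1 / F (inv_into \<Omega> \<phi> z)) (inv_into \<Omega> \<phi>) \<and>
        inverse_operator X nrm ?T
          (weighted_comp_op \<Omega> (\<lambda>z. 1 / F (inv_into \<Omega> \<phi> z)) (inv_into \<Omega> \<phi>)))"
    if A5: "\<forall>\<alpha>. automorphism \<Omega> \<alpha> \<longrightarrow> bounded_operator X nrm (comp_op \<Omega> \<alpha>)"
  proof -
    have mult: "(\<lambda>z. 1 / F z) \<in> multipliers \<Omega> X" if "invertible_operator X nrm ?T"
      using multiplier_if_inverse[OF domain(1) A5 _ F] a[OF that] that
      unfolding invertible_operator_def by blast
    have inverse: "inverse_operator X nrm ?T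
        (weighted_comp_op \<Omega> (\<lambda>z. 1 / F (inv_into \<Omega> \<phi> z)) (inv_into \<Omega> \<phi>))"
      if "automorphism \<Omega> \<phi>" "\<forall>z\<in>\<Omega>. F z \<noteq> 0" "(\<lambda>z. 1 / F z) \<in> multipliers \<Omega> X"
      using inverse_weighted_comp_op_if_multiplier[OF domain(1) A1 A5 that] .
    have "invertible_operator X nrm ?T"
      if "automorphism \<Omega> \<phi>" "\<forall>z\<in>\<Omega>. F z \<noteq> 0" "(\<lambda>z. 1 / F z) \<in> multipliers \<Omega> X"
      using inverse[OF that] bounded unfolding invertible_operator_def by blast
    moreover have "F \<in> multipliers \<Omega> X" if "automorphism \<Omega> \<phi>"
      using multiplier_if_weighted_comp_op[OF domain(1) A5 F that] bounded
      by (simp add: bounded_operator_def)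
    moreover have "wco_symbols \<Omega> (\<lambda>z. 1 / F (inv_into \<Omega> \<phi> z)) (inv_into \<Omega> \<phi>)"
      if "automorphism \<Omega> \<phi>" "\<forall>z\<in>\<Omega>. F z \<noteq> 0"
      using wco_symbols_inverse[OF domain(1) that(1) F that(2)] .
    ultimately show ?thesis
      using a mult inverse by blast
  qed
  show ?thesis
    unfolding Let_def using a b by blast
qed

end
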